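(* Let $t>2$ be an integer, $q=2$ and $p = 2^t + 2^{t-2} - 2$. Then there exists $k_0$ such that $C_{p,q}$ is a submatrix of $A_{k,t}$ for every $k\ge k_0$.
   Context: For positive integers $k,t$ with $k\ge t$, $A_{k,t}$ is the $0,1$-matrix of size $\binom{k}{t}\times\binom{k}{t}$ whose rows and columns are indexed by all $t$-element subsets of $[k]=\{1,\dots,k\}$, with entry $1$ in row $x$, column $y$ if and only if $x\cap y\neq\emptyset$. For integers $p\ge 1$, $q\ge 0$ and $n=p+q$, $C_{p,q}$ is the $n\times n$ circulant $0,1$-matrix whose entry in row $i$, column $j$ ($1\le i,j\le n$) is $1$ iff $(i-j) \bmod n \in\{0,1,\dots,p-1\}$. An $n\times m$ $0,1$-matrix $M$ is a submatrix of $A_{k,t}$ if there are distinct $t$-subsets $F_1,\dots,F_n$ of $[k]$ and distinct $t$-subsets $G_1,\dots,G_m$ of $[k]$ with $M_{ij}=1$ iff $F_i\cap G_j\ne\emptyset$. *)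

theory Defs
  imports "Jordan_Normal_Form.Matrix" "HOL-Library.Ramsey" "HOL-Library.FuncSet"
begin

text \<open>The matrix \<open>A k t\<close> is a function of its row and column labels, which are the
  \<open>t\<close>-element subsets of \<open>{1..k}\<close>; no ordering of these labels is chosen.\<close>

definition A_matrix :: "nat \<Rightarrow> nat \<Rightarrow> nat set \<Rightarrow> nat set \<Rightarrow> int" where
  "A_matrix k t = (\<lambda>x\<in>nsets {1..k} t. \<lambda>y\<in>nsets {1..k} t. of_bool (x \<inter> y \<noteq> {}))"

text \<open>Rows and columns are numbered from 0; this does not affect \<open>i - j\<close>, which is taken
  in the integers, so that \<open>mod\<close> yields the residue in \<open>{0..<p + q}\<close>.\<close>

definition C_matrix :: "nat \<Rightarrow> nat \<Rightarrow> int mat" where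
  "C_matrix p q = mat (p + q) (p + q)
     (\<lambda>(i, j). of_bool ((int i - int j) mod int (p + q) \<in> {0..<int p}))"

definition submatrix_of_A :: "int mat \<Rightarrow> nat \<Rightarrow> nat \<Rightarrow> bool" where
  "submatrix_of_A M k t \<longleftrightarrow>
     (\<exists>F G. F \<in> {..<dim_row M} \<rightarrow> nsets {1..k} t \<and> inj_on F {..<dim_row M} \<and>
            G \<in> {..<dim_col M} \<rightarrow> nsets {1..k} t \<and> inj_on G {..<dim_col M} \<and>
            (\<forall>i<dim_row M. \<forall>j<dim_col M. M $$ (i, j) = A_matrix k t (F i) (G j)))"

end

theory Submission
  imports Defs
begin

text \<open>
  With \<open>q = 2\<close> the zeros of \<open>C_matrix p q\<close> form a cycle through the \<open>2n\<close> row and column labels,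
  \<open>n = p + q\<close>. So we look for a cyclic sequence of \<open>2n\<close> sets of size \<open>t\<close>, rows at even and columns
  at odd positions, in which sets at positions of opposite parity are disjoint iff they are
  neighbours. From such a sequence \<open>x\<close> and any \<open>m \<le> 2n - 1\<close> one gets one of length \<open>2m\<close> with sets
  of size \<open>t + 1\<close>: traverse \<open>x 0, \<dots>, x m\<close> and then go back, adding one of two labels to each set.
  The labels alternate, with opposite phases on the two ways, so that a set on the way out and a set
  of opposite parity on the way back share a label, while neighbours do not. The two turning points
  \<open>x 0\<close> and \<open>x m\<close> receive a third label. Starting from \<open>n = 6\<close> at \<open>t = 2\<close> and using \<open>m = 2n - 1\<close> yields
  \<open>n = 5 * 2 ^ (t - 2) + 1\<close>; a last step with \<open>m = 2n - 2\<close> hits \<open>5 * 2 ^ (t - 2) = p + q\<close>.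
\<close>

definition cycle_adj :: "nat \<Rightarrow> nat \<Rightarrow> nat \<Rightarrow> bool" where
  "cycle_adj N a b \<longleftrightarrow> b = Suc a \<or> a = Suc b \<or> (a = 0 \<and> Suc b = N) \<or> (b = 0 \<and> Suc a = N)"

definition disjointness_cycle :: "nat \<Rightarrow> nat \<Rightarrow> (nat \<Rightarrow> nat set) \<Rightarrow> bool" where
  "disjointness_cycle t n x \<longleftrightarrow>
     (\<forall>a<2*n. finite (x a) \<and> card (x a) = t) \<and>
     (\<forall>a<2*n. \<forall>b<2*n. odd (a + b) \<longrightarrow> (x a \<inter> x b = {} \<longleftrightarrow> cycle_adj (2*n) a b))"

lemma disjointness_cycleD:
  assumes "disjointness_cycle t n x" "a < 2*n"
  shows "finite (x a)" "card (x a) = t"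
    and "b < 2*n \<Longrightarrow> odd (a + b) \<Longrightarrow> x a \<inter> x b = {} \<longleftrightarrow> cycle_adj (2*n) a b"
  using assms unfolding disjointness_cycle_def by blast+

lemma disjointness_cycle_2_6: "\<exists>x. disjointness_cycle 2 6 x"
proof -
  \<comment> \<open>A closed walk of length 12 in the Petersen graph, whose vertices are the pairs
    from \<open>{0..4}\<close>, joined if disjoint. Repeated pairs occur at positions of opposite
    parity.\<close>
  define x :: "nat \<Rightarrow> nat set" where
    "x = (!) [{0,1}, {3,4}, {1,2}, {0,4}, {2,3}, {1,4}, {0,3}, {1,2}, {3,4}, {0,2}, {1,4}, {2,3}]"
  have lt: "(\<forall>a<2*6. P a) \<longleftrightarrow> P 0 \<and> P 1 \<and> P 2 \<and> P 3 \<and> P 4 \<and> P 5 \<and> P 6 \<and> P 7 \<and> P 8 \<and> P 9 \<and> P 10 \<and> P 11"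
    for P :: "nat \<Rightarrow> bool"
    by (simp add: numeral_eq_Suc All_less_Suc) blast
  have "disjointness_cycle 2 6 x"
    unfolding disjointness_cycle_def lt by (simp add: x_def cycle_adj_def)
  then show ?thesis by blast
qed

lemma disjointness_cycle_Suc:
  assumes x: "disjointness_cycle t n x" and m: "2 \<le> m" "m < 2*n"
  shows "\<exists>y. disjointness_cycle (Suc t) m y"
proof -
  define pos where "pos a = (if a \<le> m then a else 2*m - a)" for a
  \<comment> \<open>The turning points share label 2: for \<open>m = 2*n - 1\<close> the sets
    \<open>x 0\<close> and \<open>x m\<close> are disjoint, but positions 0 and \<open>m\<close> are
    not neighbours on the new cycle.\<close>
  define lab where "lab a = (if a = 0 \<or> a = m then 2 else if even a \<longleftrightarrow> a < m then 0 else 1 :: nat)" for a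
  define y where "y a = insert (lab a) ((+) 3 ` x (pos a))" for a
  have pos: "pos a < 2*n" if "a < 2*m" for a
    using m that by (auto simp: pos_def)
  have lab: "lab a < 3" for a
    by (simp add: lab_def)
  have odd_pos: "odd (pos a + pos b) \<longleftrightarrow> odd (a + b)" if "a < 2*m" "b < 2*m" for a b
    using that by (auto simp: pos_def)
  have lab_notin: "lab a \<notin> (+) 3 ` S" for a S
    using lab[of a] by auto
  have "y a \<inter> y b = {} \<longleftrightarrow> cycle_adj (2*m) a b" if ab: "a < 2*m" "b < 2*m" "odd (a + b)" for a b
  proof -
    have "y a \<inter> y b = {} \<longleftrightarrow> lab a \<noteq> lab b \<and> (+) 3 ` x (pos a) \<inter> (+) 3 ` x (pos b) = {}"
      using lab_notin[of a] lab_notin[of b] by (auto simp: y_def)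
    also have "(+) 3 ` x (pos a) \<inter> (+) 3 ` x (pos b) = {} \<longleftrightarrow> x (pos a) \<inter> x (pos b) = {}"
      by auto
    also have "\<dots> \<longleftrightarrow> cycle_adj (2*n) (pos a) (pos b)"
      using disjointness_cycleD(3)[OF x] pos odd_pos ab by blast
    also have "lab a \<noteq> lab b \<and> cycle_adj (2*n) (pos a) (pos b) \<longleftrightarrow> cycle_adj (2*m) a b"
      using ab m unfolding lab_def pos_def cycle_adj_def
      by (cases "even a"; auto split: if_splits)
    finally show ?thesis .
  qed
  moreover have "finite (y a) \<and> card (y a) = Suc t" if "a < 2*m" for a
    using disjointness_cycleD(1,2)[OF x pos[OF that]] lab_notin[of a]
    by (simp add: y_def card_image)
  ultimately have "disjointness_cycle (Suc t) m y"
    by (simp add: disjointness_cycle_def)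
  then show ?thesis by blast
qed

lemma disjointness_cycle_exists: "\<exists>x. disjointness_cycle (s + 2) (5 * 2 ^ s + 1) x"
proof (induction s)
  case 0
  then show ?case using disjointness_cycle_2_6 by (simp add: numeral_2_eq_2)
next
  case (Suc s)
  then obtain x where "disjointness_cycle (s + 2) (5 * 2 ^ s + 1) x" by blast
  from disjointness_cycle_Suc[OF this, of "5 * 2 ^ Suc s + 1"] show ?case by simp
qed

text \<open>Equal sets at positions of equal parity have the same neighbours, and on a cycle of
  length at least 6 two neighbours determine the position between them. On a 4-cycle they would
  not.\<close>

lemma disjointness_cycle_inj:
  assumes x: "disjointness_cycle t n x" and n: "n \<ge> 3"
    and ab: "a < 2*n" "b < 2*n" "even (a + b)" "x a = x b"
  shows "a = b"
proof -
  define nxt where "nxt = (if Suc a = 2*n then 0 else Suc a)"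
  define prv where "prv = (if a = 0 then 2*n - 1 else a - 1)"
  have lt: "nxt < 2*n" "prv < 2*n"
    using ab n by (auto simp: nxt_def prv_def)
  have odd: "odd (a + nxt)" "odd (a + prv)" "odd (b + nxt)" "odd (b + prv)"
    using ab n by (auto simp: nxt_def prv_def) presburger+
  have "cycle_adj (2*n) a nxt" "cycle_adj (2*n) a prv"
    using ab n by (auto simp: nxt_def prv_def cycle_adj_def)
  then have "cycle_adj (2*n) b nxt" "cycle_adj (2*n) b prv"
    using disjointness_cycleD(3)[OF x] ab lt odd by metis+
  then show ?thesis
    using ab n unfolding nxt_def prv_def cycle_adj_def
    by (auto split: if_splits)
qed

lemma submatrix_of_A_if_disjointness_cycle:
  assumes x: "disjointness_cycle t (p + 2) x" and p: "p \<ge> 1"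
  shows "\<exists>k0. \<forall>k\<ge>k0. submatrix_of_A (C_matrix p 2) k t"
proof -
  define n where "n = p + 2"
  note x = x[folded n_def]
  \<comment> \<open>Row \<open>i\<close> has its zeros in columns \<open>i + 1\<close> and
    \<open>i + 2\<close> modulo \<open>n\<close>. With row \<open>i\<close> at position
    \<open>2*i\<close>, these must sit at \<open>2*i - 1\<close> and \<open>2*i + 1\<close>, so
    column \<open>j\<close> goes to \<open>2*j - 3\<close> modulo \<open>2*n\<close>.\<close>
  define col where "col j = (if j < 2 then 2*j + 2*n - 3 else 2*j - 3)" for j
  have n: "n \<ge> 3"
    using p by (simp add: n_def)
  have col: "col j < 2*n" "odd (col j)" if "j < n" for j
    using that n by (auto simp: col_def)
  have inj_col: "inj_on col {..<n}"
    using n by (auto simp: inj_on_def col_def split: if_splits)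
  have "finite (\<Union>a<2*n. x a)"
    using disjointness_cycleD(1)[OF x] by blast
  then obtain B where B: "\<And>a v. a < 2*n \<Longrightarrow> v \<in> x a \<Longrightarrow> v < B"
    unfolding finite_nat_set_iff_bounded by blast
  have "submatrix_of_A (C_matrix p 2) k t" if "k \<ge> B" for k
  proof -
    \<comment> \<open>The sets may contain 0; \<open>Suc\<close> moves them from below
      \<open>B\<close> into \<open>{1..k}\<close>.\<close>
    have nsets: "Suc ` x a \<in> nsets {1..k} t" if "a < 2*n" for a
      using disjointness_cycleD(1,2)[OF x that] B[OF that] \<open>k \<ge> B\<close>
      by (fastforce simp: nsets_def card_image)
    have inj: "Suc ` x a = Suc ` x b \<Longrightarrow> a = b" if "a < 2*n" "b < 2*n" "even (a + b)" for a b
      using disjointness_cycle_inj[OF x n that] by (simp add: inj_image_eq_iff)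
    have entry: "C_matrix p 2 $$ (i, j) = A_matrix k t (Suc ` x (2*i)) (Suc ` x (col j))"
      if "i < n" "j < n" for i j
    proof -
      have "(int i - int j) mod int n = (if j \<le> i then int i - int j else int i - int j + int n)"
        using that mod_pos_pos_trivial[of "int i - int j + int n" "int n"] by auto
      then have "(int i - int j) mod int n \<in> {0..<int p} \<longleftrightarrow>
          \<not> (j = i + 1 \<or> j = i + 2 \<or> j + n = i + 1 \<or> j + n = i + 2)"
        using that by (simp add: n_def) linarith
      also have "\<dots> \<longleftrightarrow> \<not> cycle_adj (2*n) (2*i) (col j)"
        using that n by (cases "j < 2"; simp add: cycle_adj_def col_def; linarith)
      also have "\<dots> \<longleftrightarrow> x (2*i) \<inter> x (col j) \<noteq> {}"
        using disjointness_cycleD(3)[OF x] that col by simp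
      also have "\<dots> \<longleftrightarrow> Suc ` x (2*i) \<inter> Suc ` x (col j) \<noteq> {}"
        by auto
      finally show ?thesis
        using that nsets col by (simp add: C_matrix_def A_matrix_def n_def)
    qed
    have inj_row: "inj_on (\<lambda>i. Suc ` x (2*i)) {..<n}"
    proof (rule inj_onI)
      fix i j
      assume "i \<in> {..<n}" "j \<in> {..<n}" "Suc ` x (2*i) = Suc ` x (2*j)"
      then show "i = j" using inj[of "2*i" "2*j"] by simp
    qed
    have inj_column: "inj_on (\<lambda>j. Suc ` x (col j)) {..<n}"
    proof (rule inj_onI)
      fix i j
      assume ij: "i \<in> {..<n}" "j \<in> {..<n}" "Suc ` x (col i) = Suc ` x (col j)"
      then have "col i = col j"
        using inj[of "col i" "col j"] col[of i] col[of j] by simp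
      with inj_col ij show "i = j" by (simp add: inj_on_def)
    qed
    have dim: "dim_row (C_matrix p 2) = n" "dim_col (C_matrix p 2) = n"
      by (simp_all add: C_matrix_def n_def)
    have "(\<lambda>i. Suc ` x (2*i)) \<in> {..<n} \<rightarrow> nsets {1..k} t"
      "(\<lambda>j. Suc ` x (col j)) \<in> {..<n} \<rightarrow> nsets {1..k} t"
      using nsets col by auto
    with inj_row inj_column entry show ?thesis
      unfolding submatrix_of_A_def dim by blast
  qed
  then show ?thesis by blast
qed

theorem theorem4:
  fixes t p q :: nat
  assumes "t > 2" and "q = 2" and "p = 2 ^ t + 2 ^ (t - 2) - 2"
  shows "\<exists>k0. \<forall>k\<ge>k0. submatrix_of_A (C_matrix p q) k t"
proof -
  \<comment> \<open>The last step starts at size \<open>t - 1\<close>, which must be at least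
    2.\<close>
  obtain s where t: "t = Suc (s + 2)"
    using assms(1) that[of "t - 3"] by simp
  have pow: "(1::nat) \<le> 2 ^ s"
    by simp
  have "p = 10 * 2 ^ s - 2"
    by (simp add: assms(3) t)
  with pow have p: "p + 2 = 10 * 2 ^ s"
    by linarith
  obtain x where "disjointness_cycle (s + 2) (5 * 2 ^ s + 1) x"
    using disjointness_cycle_exists by blast
  from disjointness_cycle_Suc[OF this, of "p + 2"]
  obtain y where "disjointness_cycle t (p + 2) y"
    unfolding p t using pow by auto
  moreover have "p \<ge> 1"
    using p pow by linarith
  ultimately show ?thesis
    using submatrix_of_A_if_disjointness_cycle assms(2) by blast
qed

end
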